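(* Let $$\lambda^*=\frac{\sin\theta_1^*}{\theta_1^*}=0.3108\ldots.$$ For $1/4<\lambda\leq\lambda^*$ let $\theta_1(\lambda)\in(0,\pi)$ be the unique root (which exists) of the equation $$\cos x\,(2-\lambda x^2)+(1+\lambda)x\sin x-2=0,\qquad x\in(0,\pi),$$ and let $\theta_1(\lambda)=0$ for $0\leq\lambda\leq1/4$. Then $\theta_1(\lambda^* )=\theta_1^*$, $q_1(\lambda)=1-\lambda$ for $0\leq\lambda\leq1/4$, and $$q_1(\lambda)=\sqrt{\Big(\frac{\cos x-1}{x}\Big)^2+\Big(\frac{\sin x-\lambda x}{x}\Big)^2}\,\bigg|_{x=\theta_1(\lambda)},\qquad \frac14<\lambda\leq\lambda^*.$$ Moreover, the function $\lambda+q_1(\lambda)$ is strictly increasing for $1/4<\lambda\leq\lambda^*$, and the function $q_1(\lambda)$ is strictly decreasing for $0\leq\lambda\leq\lambda^*$. In particular, $$q_1(1/4)=3/4,\qquad \inf_{\lambda\geq0}q_1(\lambda)=q_1(\lambda^* )=\sup_{x>0}\frac{1-\cos x}{x}=0.724611\ldots.$$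
   Context: For $\lambda\geq0$, $$q_1(\lambda)=\sup_{x>0}\frac{1}{x}\left|e^{ix}-1-\lambda\, ix\right|.$$ The number $\theta_1^*=2.3311\ldots$ is the unique root of the equation $x\sin x+\cos x-1=0$ in the interval $(0,\pi)$. *)

theory Defs
  imports "HOL-Analysis.Analysis"
begin

text \<open>
  The supremum is that of a nonempty set of reals which is bounded above
  (by \<^term>\<open>1 + \<bar>lam\<bar>\<close>), so the conditionally complete \<^const>\<open>Sup\<close> is the genuine one.
\<close>
definition q1 :: "real \<Rightarrow> real" where
  "q1 lam = (SUP x\<in>{0<..}.
     (1 / x) * cmod (exp (\<i> * complex_of_real x) - 1
                      - complex_of_real lam * (\<i> * complex_of_real x)))"

definition is_theta1_star :: "real \<Rightarrow> bool" where
  "is_theta1_star x \<longleftrightarrow> x \<in> {0<..<pi} \<and> x * sin x + cos x - 1 = 0"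

definition theta1_star :: real where
  "theta1_star = (THE x. is_theta1_star x)"

definition lambda_star :: real where
  "lambda_star = sin theta1_star / theta1_star"

definition is_theta1 :: "real \<Rightarrow> real \<Rightarrow> bool" where
  "is_theta1 lam x \<longleftrightarrow> x \<in> {0<..<pi} \<and>
     cos x * (2 - lam * x\<^sup>2) + (1 + lam) * x * sin x - 2 = 0"

text \<open>
  Only the values for \<^term>\<open>0 \<le> lam \<and> lam \<le> lambda_star\<close> are meaningful.
\<close>
definition theta1 :: "real \<Rightarrow> real" where
  "theta1 lam = (if lam \<le> 1/4 then 0 else (THE x. is_theta1 lam x))"

end

theory Submission
  imports Defs "HOL-Real_Asymp.Real_Asymp"
begin

text \<open>
  The square of the quotient in the definition of \<open>q1\<close> has a derivative whose sign is that of
  \<open>\<lambda> - crit x\<close>, where \<open>crit x = (2 - 2 cos x - x sin x) / (x sin x - x\<^sup>2 cos x)\<close>.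
  By the monotone form of l'Hopital's rule, \<open>crit\<close> increases strictly on \<open>(0, \<pi>)\<close>, starting from the
  limit \<open>1/4\<close> and taking the value \<open>\<lambda>\<^sup>*\<close> at \<open>\<theta>\<^sub>1\<^sup>*\<close>; so for \<open>1/4 < \<lambda> \<le> \<lambda>\<^sup>*\<close> its inverse \<open>\<theta>\<^sub>1\<close> is the
  maximizer on \<open>(0, \<pi>)\<close>, and a crude estimate excludes \<open>[\<pi>, \<infinity>)\<close>.
  Both monotonicity claims follow from the convexity of \<open>q1\<close>, a supremum of norms of functions affine
  in \<open>\<lambda>\<close>: it has a strict minimum at \<open>\<lambda>\<^sup>*\<close>, because the real part of the quotient does not depend
  on \<open>\<lambda>\<close> and the imaginary part at \<open>\<theta>\<^sub>1\<^sup>*\<close> vanishes only for \<open>\<lambda> = \<lambda>\<^sup>*\<close>; and \<open>\<lambda> + q1 \<lambda>\<close> equals \<open>1\<close>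
  on \<open>[0, 1/4]\<close> and exceeds \<open>1\<close> afterwards.
\<close>

section \<open>Numerical values of sine and cosine near \<open>theta1_star\<close>\<close>

text \<open>For arguments near 2.33 the remainder is below 10^-9, well inside the margins of about 2
  * 10^-8 used below.\<close>

lemma sin_Taylor_bound:
  fixes x :: real
  shows "\<bar>sin x - (x - x^3/6 + x^5/120 - x^7/5040 + x^9/362880 - x^11/39916800 + x^13/6227020800
    - x^15/1307674368000 + x^17/355687428096000)\<bar> \<le> \<bar>x\<bar>^18/6402373705728000"
  using Maclaurin_sin_bound[of x 18]
  by (simp add: sin_coeff_def lessThan_nat_numeral lessThan_Suc fact_numeral field_simps)

text \<open>The rationals \<open>4217/1809\<close> and \<open>4569/1960\<close> enclose \<open>\<theta>\<^sub>1\<^sup>*\<close> tightly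
  enough for six decimals of \<open>q1 \<lambda>\<^sup>*\<close>. The cosine is estimated through \<open>sin\<^sup>2 + cos\<^sup>2 = 1\<close>.\<close>

lemma sin_cos_numeric_left:
  fixes x :: real defines "x \<equiv> 4217/1809"
  shows "sin x < 0.7246117" "0 < x * sin x + cos x - 1"
proof -
  have s: "0.724611484 \<le> sin x" "sin x \<le> 0.724611504"
    using sin_Taylor_bound[of x] unfolding abs_le_iff x_def by (simp_all add: power_divide)
  have c: "-0.6891576 \<le> cos x"
  proof (rule ccontr)
    assume "\<not> -0.6891576 \<le> cos x"
    then have "0.6891576 * 0.6891576 \<le> (- cos x) * (- cos x)"
      by (intro mult_mono) simp_all
    moreover have "0.724611484 * 0.724611484 \<le> sin x * sin x"
      using s by (intro mult_mono) simp_all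
    moreover have "cos x * cos x = 1 - sin x * sin x"
      by (simp add: eq_diff_eq)
    ultimately show False by simp
  qed
  show "sin x < 0.7246117" using s by simp
  show "0 < x * sin x + cos x - 1" using s c by (simp add: x_def)
qed

lemma sin_cos_numeric_right:
  fixes x :: real defines "x \<equiv> 4569/1960"
  shows "0.724611 < sin x" "x * sin x + cos x - 1 < 0"
proof -
  have s: "0.724611289 \<le> sin x" "sin x \<le> 0.724611310"
    using sin_Taylor_bound[of x] unfolding abs_le_iff x_def by (simp_all add: power_divide)
  have "cos x \<le> 0"
    using cos_monotone_0_pi_le[of "pi / 2" x] pi_approx by (simp add: x_def)
  have c: "cos x \<le> -0.68915777"
  proof (rule ccontr)
    assume "\<not> cos x \<le> -0.68915777"
    then have "(- cos x) * (- cos x) \<le> 0.68915777 * 0.68915777"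
      using \<open>cos x \<le> 0\<close> by (intro mult_mono) simp_all
    moreover have "sin x * sin x \<le> 0.724611310 * 0.724611310"
      using s by (intro mult_mono) simp_all
    moreover have "cos x * cos x = 1 - sin x * sin x"
      by (simp add: eq_diff_eq)
    ultimately show False by simp
  qed
  show "0.724611 < sin x" using s by simp
  show "x * sin x + cos x - 1 < 0" using s c by (simp add: x_def)
qed

section \<open>Elementary trigonometric inequalities\<close>

lemma less_of_deriv_pos:
  fixes f f' :: "real \<Rightarrow> real"
  assumes "a < b" "\<And>x. (f has_real_derivative f' x) (at x)"
    and "\<And>x. a < x \<Longrightarrow> x < b \<Longrightarrow> 0 < f' x"
  shows "f a < f b"
  using assms by (intro DERIV_pos_imp_increasing_open[OF \<open>a < b\<close>])
    (auto intro!: DERIV_atLeastAtMost_imp_continuous_on)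

text \<open>First link of a chain of four inequalities: each later difference vanishes at 0 and has
  the preceding difference as its derivative.\<close>

lemma x_cos_less_sin:
  fixes x :: real assumes "0 < x" "x \<le> pi" shows "x * cos x < sin x"
proof -
  have "(\<lambda>x. sin x - x * cos x) 0 < (\<lambda>x. sin x - x * cos x) x"
  proof (rule less_of_deriv_pos[where f = "\<lambda>x. sin x - x * cos x" and f' = "\<lambda>y. y * sin y"])
    show "((\<lambda>x. sin x - x * cos x) has_real_derivative y * sin y) (at y)" for y
      by (auto intro!: derivative_eq_intros simp: algebra_simps)
    show "0 < y * sin y" if "0 < y" "y < x" for y
      using that assms by (simp add: sin_gt_zero)
  qed (use assms in simp)
  then show ?thesis by simp
qed

lemma crit_numerator_pos:
  fixes x :: real assumes "0 < x" "x \<le> pi" shows "0 < 2 - 2 * cos x - x * sin x"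
proof -
  have "(\<lambda>x. 2 - 2 * cos x - x * sin x) 0 < (\<lambda>x. 2 - 2 * cos x - x * sin x) x"
  proof (rule less_of_deriv_pos[where f = "\<lambda>x. 2 - 2 * cos x - x * sin x" and f' = "\<lambda>y. sin y - y * cos y"])
    show "((\<lambda>x. 2 - 2 * cos x - x * sin x) has_real_derivative sin y - y * cos y) (at y)" for y
      by (auto intro!: derivative_eq_intros simp: algebra_simps)
    show "0 < sin y - y * cos y" if "0 < y" "y < x" for y
      using that assms x_cos_less_sin[of y] by auto
  qed (use assms in simp)
  then show ?thesis by simp
qed

lemma three_sin_minus_x_cos_less:
  fixes x :: real assumes "0 < x" shows "0 < 2 * x - 3 * sin x + x * cos x"
proof (cases "x \<le> pi")
  case True
  have "(\<lambda>x. 2 * x - 3 * sin x + x * cos x) 0 < (\<lambda>x. 2 * x - 3 * sin x + x * cos x) x"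
  proof (rule less_of_deriv_pos[where f = "\<lambda>x. 2 * x - 3 * sin x + x * cos x" and f' = "\<lambda>y. 2 - 2 * cos y - y * sin y"])
    show "((\<lambda>x. 2 * x - 3 * sin x + x * cos x) has_real_derivative 2 - 2 * cos y - y * sin y) (at y)" for y
      by (auto intro!: derivative_eq_intros simp: algebra_simps)
    show "0 < 2 - 2 * cos y - y * sin y" if "0 < y" "y < x" for y
      using that True crit_numerator_pos[of y] by auto
  qed (use assms in simp)
  then show ?thesis by simp
next
  \<comment> \<open>Beyond \<open>pi\<close> the derivative argument is replaced by the crude bound
    \<open>2 * x - 3 - x > 0\<close>.\<close>
  case False
  have "x * cos x \<ge> x * (-1)" using assms by (intro mult_left_mono) auto
  moreover have "sin x \<le> 1" by simp
  ultimately show ?thesis using False pi_gt3 by linarith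
qed

text \<open>Used twice: at \<open>x\<close> it is the case \<open>lam = 1/4\<close> of the upper
  bound \<open>q1_le\<close>, and at \<open>2 * x\<close> it makes the quotient in
  \<open>sin_minus_x_cos_quotient_strict_mono\<close> increase.\<close>

lemma four_one_minus_cos_less:
  fixes x :: real assumes "0 < x" shows "4 * (1 - cos x) - x * sin x < x\<^sup>2"
proof -
  have "(\<lambda>x. x\<^sup>2 + x * sin x + 4 * cos x - 4) 0 < (\<lambda>x. x\<^sup>2 + x * sin x + 4 * cos x - 4) x"
  proof (rule less_of_deriv_pos[where f = "\<lambda>x. x\<^sup>2 + x * sin x + 4 * cos x - 4" and f' = "\<lambda>y. 2 * y - 3 * sin y + y * cos y"])
    show "((\<lambda>x. x\<^sup>2 + x * sin x + 4 * cos x - 4) has_real_derivative 2 * y - 3 * sin y + y * cos y) (at y)" for y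
      by (auto intro!: derivative_eq_intros simp: algebra_simps)
    show "0 < 2 * y - 3 * sin y + y * cos y" if "0 < y" "y < x" for y
      using that three_sin_minus_x_cos_less[of y] by auto
  qed (use assms in simp)
  then show ?thesis by simp
qed

section \<open>Monotonicity of \<open>crit\<close> and its limit at 0\<close>

text \<open>Cauchy's mean value theorem on [0, x] and on [x, y] gives
  \<open>f x / g x = f' c / g' c\<close> and an increment quotient \<open>f' d / g' d\<close> with
  \<open>c < x < d\<close>. The second is larger, and \<open>f y / g y\<close> is a weighted mean of
  the two with positive weights.\<close>

lemma strict_mono_on_quotient_lHopital:
  fixes f g f' g' :: "real \<Rightarrow> real"
  assumes f: "\<And>x. 0 \<le> x \<Longrightarrow> x < b \<Longrightarrow> (f has_real_derivative f' x) (at x)"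
    and g: "\<And>x. 0 \<le> x \<Longrightarrow> x < b \<Longrightarrow> (g has_real_derivative g' x) (at x)"
    and 0: "f 0 = 0" "g 0 = 0"
    and g'_pos: "\<And>x. 0 < x \<Longrightarrow> x < b \<Longrightarrow> 0 < g' x"
    and mono: "strict_mono_on {0<..<b} (\<lambda>x. f' x / g' x)"
  shows "strict_mono_on {0<..<b} (\<lambda>x. f x / g x)"
proof (rule strict_mono_onI)
  have incr: "g x < g y" if "0 \<le> x" "x < y" "y < b" for x y
  proof (rule DERIV_pos_imp_increasing_open[OF \<open>x < y\<close>])
    show "\<exists>d. (g has_real_derivative d) (at z) \<and> 0 < d" if "x < z" "z < y" for z
      using g[of z] g'_pos[of z] that \<open>0 \<le> x\<close> \<open>y < b\<close> by auto
    show "continuous_on {x..y} g"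
      using g that by (intro DERIV_atLeastAtMost_imp_continuous_on) (metis order.strict_trans1 order_trans)
  qed
  have cauchy: "\<exists>c. x < c \<and> c < y \<and> f y - f x = (g y - g x) * (f' c / g' c)"
    if "0 \<le> x" "x < y" "y < b" for x y
  proof -
    have "\<exists>c>x. c < y \<and> (f y - f x) * g' c = (g y - g x) * f' c"
    proof (rule GMVT'[OF \<open>x < y\<close>])
      fix z assume "x \<le> z" "z \<le> y"
      then show "isCont f z" "isCont g z"
        using that DERIV_isCont[OF f[of z]] DERIV_isCont[OF g[of z]] by auto
    next
      fix z assume "x < z" "z < y"
      then show "(f has_real_derivative f' z) (at z)" "(g has_real_derivative g' z) (at z)"
        using that f[of z] g[of z] by auto
    qed
    then obtain c where "x < c" "c < y" "(f y - f x) * g' c = (g y - g x) * f' c" by blast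
    moreover have "g' c > 0" using that calculation by (intro g'_pos) auto
    ultimately show ?thesis by (auto simp: field_simps)
  qed
  fix x y assume xy: "x \<in> {0<..<b}" "y \<in> {0<..<b}" "x < y"
  obtain c where c: "0 < c" "c < x" "f x = g x * (f' c / g' c)"
    using cauchy[of 0 x] xy 0 by auto
  obtain d where d: "x < d" "d < y" "f y - f x = (g y - g x) * (f' d / g' d)"
    using cauchy[of x y] xy by auto
  define r where "r = f' c / g' c"
  define q where "q = f' d / g' d"
  have "r < q"
    unfolding r_def q_def using c d xy by (intro strict_mono_onD[OF mono]) auto
  then have "(g y - g x) * r < (g y - g x) * q"
    using incr[of x y] xy by (intro mult_strict_left_mono) auto
  moreover have "f x = g x * r" "f y - f x = (g y - g x) * q"
    using c(3) d(3) by (simp_all only: r_def q_def)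
  ultimately have "g y * r < f y" by (simp add: algebra_simps)
  moreover have "r = f x / g x" "g x > 0" "g y > 0"
    using \<open>f x = g x * r\<close> incr[of 0 x] incr[of 0 y] 0 xy by auto
  ultimately show "f x / g x < f y / g y"
    by (simp only: pos_less_divide_eq) (simp add: mult.commute)
qed

text \<open>With \<open>u = sin x - x * cos x\<close> and \<open>v = x\<^sup>2 * sin x\<close>, the
  quotient of derivatives belonging to \<open>crit\<close> is \<open>u / (u + v)\<close>, which
  increases together with \<open>u / v\<close>.\<close>

lemma sin_minus_x_cos_quotient_strict_mono:
  "strict_mono_on {0<..<pi} (\<lambda>x. (sin x - x * cos x) / (x\<^sup>2 * sin x))"
proof (rule strict_mono_onI)
  fix a b :: real assume ab: "a \<in> {0<..<pi}" "b \<in> {0<..<pi}" "a < b"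
  let ?P = "\<lambda>x::real. (sin x - x * cos x) / (x\<^sup>2 * sin x)"
  show "?P a < ?P b"
  proof (rule DERIV_pos_imp_increasing[OF \<open>a < b\<close>])
    fix x assume "a \<le> x" "x \<le> b"
    then have x: "0 < x" "x < pi" using ab by auto
    then have s: "sin x > 0" by (simp add: sin_gt_zero)
    let ?d = "x * (x\<^sup>2 - 2 * (sin x)\<^sup>2 + x * sin x * cos x) / (x\<^sup>2 * sin x)\<^sup>2"
    have "(?P has_real_derivative
        (x * sin x * (x\<^sup>2 * sin x) - (sin x - x * cos x) * (2 * x * sin x + x\<^sup>2 * cos x)) / (x\<^sup>2 * sin x)\<^sup>2) (at x)"
      using x s by (auto intro!: derivative_eq_intros simp: algebra_simps power2_eq_square)
    also have "x * sin x * (x\<^sup>2 * sin x) - (sin x - x * cos x) * (2 * x * sin x + x\<^sup>2 * cos x)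
        = x * (x\<^sup>2 * ((sin x)\<^sup>2 + (cos x)\<^sup>2) - 2 * (sin x)\<^sup>2 + x * sin x * cos x)"
      by algebra
    also have "\<dots> = x * (x\<^sup>2 - 2 * (sin x)\<^sup>2 + x * sin x * cos x)"
      by (simp only: sin_cos_squared_add mult_1_right)
    finally have "(?P has_real_derivative ?d) (at x)" .
    \<comment> \<open>By the double-angle formulas this is \<open>four_one_minus_cos_less\<close> at
      \<open>2 * x\<close>, divided by 4.\<close>
    moreover have "x\<^sup>2 - 2 * (sin x)\<^sup>2 + x * sin x * cos x > 0"
      using four_one_minus_cos_less[of "2 * x"] x by (simp add: cos_double_sin sin_double power2_eq_square)
    then have "?d > 0" using x s by simp
    ultimately show "\<exists>y. (?P has_real_derivative y) (at x) \<and> 0 < y" by blast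
  qed
qed

text \<open>The equation in \<open>is_theta1\<close> is affine in \<open>lam\<close>; this is its
  solution for \<open>lam\<close>.\<close>

definition crit :: "real \<Rightarrow> real" where
  "crit x = (2 - 2 * cos x - x * sin x) / (x * sin x - x\<^sup>2 * cos x)"

lemma crit_strict_mono: "strict_mono_on {0<..<pi} crit"
  unfolding crit_def[abs_def]
proof (rule strict_mono_on_quotient_lHopital)
  fix x :: real assume x: "0 \<le> x" "x < pi"
  show "((\<lambda>x. 2 - 2 * cos x - x * sin x) has_real_derivative sin x - x * cos x) (at x)"
    by (auto intro!: derivative_eq_intros)
  show "((\<lambda>x. x * sin x - x\<^sup>2 * cos x) has_real_derivative sin x - x * cos x + x\<^sup>2 * sin x) (at x)"
    by (auto intro!: derivative_eq_intros simp: algebra_simps)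
next
  fix x :: real assume x: "0 < x" "x < pi"
  show "sin x - x * cos x + x\<^sup>2 * sin x > 0"
    using x_cos_less_sin[of x] x sin_gt_zero[of x] by (simp add: add_pos_pos)
next
  show "strict_mono_on {0<..<pi} (\<lambda>x. (sin x - x * cos x) / (sin x - x * cos x + x\<^sup>2 * sin x))"
  proof (rule strict_mono_onI)
    fix a b :: real assume ab: "a \<in> {0<..<pi}" "b \<in> {0<..<pi}" "a < b"
    have *: "u / (u + v) < u' / (u' + v')" if "u / v < u' / v'" "0 < u" "0 < v" "0 < u'" "0 < v'"
      for u v u' v' :: real
    proof -
      have "u * v' < u' * v" using that by (simp add: field_simps)
      then show ?thesis using that by (simp add: divide_less_eq less_divide_eq field_simps add_pos_pos)
    qed
    show "(sin a - a * cos a) / (sin a - a * cos a + a\<^sup>2 * sin a)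
        < (sin b - b * cos b) / (sin b - b * cos b + b\<^sup>2 * sin b)"
      using strict_mono_onD[OF sin_minus_x_cos_quotient_strict_mono ab(1,2,3)] x_cos_less_sin[of a] x_cos_less_sin[of b]
        ab sin_gt_zero[of a] sin_gt_zero[of b] by (intro *) auto
  qed
qed auto

text \<open>Numerator and denominator begin with \<open>x^4 / 12\<close> and \<open>x^4 / 3\<close>,
  which is the origin of the threshold 1/4.\<close>

lemma crit_lim: "(crit \<longlongrightarrow> 1/4) (at_right 0)"
  unfolding crit_def[abs_def] by real_asymp

section \<open>The squared quotient and its supremum\<close>

text \<open>The square of the quotient in \<open>q1\<close>, already simplified by
  \<open>sin\<^sup>2 + cos\<^sup>2 = 1\<close>.\<close>

definition ratio_sq :: "real \<Rightarrow> real \<Rightarrow> real" where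
  "ratio_sq lam x = 2 * (1 - cos x) / x\<^sup>2 - 2 * lam * sin x / x + lam\<^sup>2"

lemma ratio_sq_mult:
  assumes "x \<noteq> 0"
  shows "ratio_sq lam x * x\<^sup>2 = 2 * (1 - cos x) - 2 * lam * (x * sin x) + lam\<^sup>2 * x\<^sup>2"
  using assms by (simp add: ratio_sq_def field_simps power2_eq_square)

lemma ratio_sq_eq:
  assumes "x \<noteq> 0"
  shows "ratio_sq lam x = ((cos x - 1) / x)\<^sup>2 + ((sin x - lam * x) / x)\<^sup>2"
proof -
  have "(cos x - 1)\<^sup>2 + (sin x - lam * x)\<^sup>2
      = (sin x)\<^sup>2 + (cos x)\<^sup>2 - 2 * cos x + 1 - 2 * lam * x * sin x + lam\<^sup>2 * x\<^sup>2"
    by (simp only: power2_diff) (simp add: algebra_simps power2_eq_square)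
  also have "\<dots> = ratio_sq lam x * x\<^sup>2"
    using assms by (simp add: ratio_sq_mult)
  finally show ?thesis
    using assms by (simp add: power_divide add_divide_distrib[symmetric] field_simps)
qed

lemma norm_eq_sqrt_ratio_sq:
  assumes "0 < x"
  shows "(1 / x) * cmod (exp (\<i> * complex_of_real x) - 1
      - complex_of_real lam * (\<i> * complex_of_real x)) = sqrt (ratio_sq lam x)"
proof -
  have "cmod (exp (\<i> * complex_of_real x) - 1 - complex_of_real lam * (\<i> * complex_of_real x))
      = sqrt ((cos x - 1)\<^sup>2 + (sin x - lam * x)\<^sup>2)"
    by (simp add: cmod_def Re_exp Im_exp)
  also have "(cos x - 1)\<^sup>2 + (sin x - lam * x)\<^sup>2 = x\<^sup>2 * ratio_sq lam x"
    using assms by (simp add: ratio_sq_eq power_divide field_simps)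
  finally show ?thesis using assms by (simp add: real_sqrt_mult)
qed

lemma q1_eq: "q1 lam = (SUP x\<in>{0<..}. sqrt (ratio_sq lam x))"
  unfolding q1_def by (intro SUP_cong) (auto simp: norm_eq_sqrt_ratio_sq[symmetric])

text \<open>Since \<open>|exp (i x) - 1| = 2 |sin (x / 2)| \<le> x\<close>. The uniform bound makes
  the supremum in \<open>q1\<close> well behaved.\<close>

lemma sqrt_ratio_sq_le:
  assumes "0 < x"
  shows "sqrt (ratio_sq lam x) \<le> 1 + \<bar>lam\<bar>"
proof -
  have "cmod (exp (\<i> * complex_of_real x) - 1 - complex_of_real lam * (\<i> * complex_of_real x))
      \<le> 2 * \<bar>sin (x / 2)\<bar> + \<bar>lam\<bar> * x"
    using norm_triangle_ineq4[of "exp (\<i> * complex_of_real x) - 1" "complex_of_real lam * (\<i> * complex_of_real x)"]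
      assms by (simp only: dist_exp_i_1) (simp add: norm_mult)
  also have "\<dots> \<le> x * (1 + \<bar>lam\<bar>)"
    using abs_sin_x_le_abs_x[of "x / 2"] assms by (simp add: algebra_simps)
  finally show ?thesis
    using assms by (simp add: norm_eq_sqrt_ratio_sq[symmetric] field_simps)
qed

lemma sqrt_ratio_sq_le_q1: "0 < x \<Longrightarrow> sqrt (ratio_sq lam x) \<le> q1 lam"
  unfolding q1_eq by (rule cSUP_upper) (auto intro!: bdd_aboveI sqrt_ratio_sq_le)

lemma q1_leI: "(\<And>x. 0 < x \<Longrightarrow> sqrt (ratio_sq lam x) \<le> c) \<Longrightarrow> q1 lam \<le> c"
  unfolding q1_eq by (rule cSUP_least) auto

section \<open>Convexity of \<open>q1\<close> and its values on [0, 1/4]\<close>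

lemma convex_on_q1: "convex_on UNIV q1"
proof (rule convex_onI)
  fix t a b :: real assume t: "0 < t" "t < 1"
  show "q1 ((1 - t) *\<^sub>R a + t *\<^sub>R b) \<le> (1 - t) * q1 a + t * q1 b"
  proof (rule q1_leI)
    fix x :: real assume x: "0 < x"
    define F where "F lam = exp (\<i> * complex_of_real x) - 1 - complex_of_real lam * (\<i> * complex_of_real x)" for lam
    have F: "cmod (F lam) \<le> x * q1 lam" for lam
      using sqrt_ratio_sq_le_q1[OF x, of lam] x by (simp add: norm_eq_sqrt_ratio_sq[symmetric] F_def field_simps)
    have "F ((1 - t) *\<^sub>R a + t *\<^sub>R b) = complex_of_real (1 - t) * F a + complex_of_real t * F b"
      by (simp add: F_def algebra_simps)
    then have "cmod (F ((1 - t) *\<^sub>R a + t *\<^sub>R b)) \<le> cmod (complex_of_real (1 - t) * F a) + cmod (complex_of_real t * F b)"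
      by (simp only: norm_triangle_ineq)
    also have "\<dots> = (1 - t) * cmod (F a) + t * cmod (F b)"
      using t by (simp only: norm_mult norm_of_real abs_of_pos diff_gt_0_iff_gt)
    also have "\<dots> \<le> (1 - t) * (x * q1 a) + t * (x * q1 b)"
      using t by (intro add_mono mult_left_mono F) auto
    finally show "sqrt (ratio_sq ((1 - t) *\<^sub>R a + t *\<^sub>R b) x) \<le> (1 - t) * q1 a + t * q1 b"
      using x by (simp add: norm_eq_sqrt_ratio_sq[symmetric] F_def field_simps)
  qed
qed simp

lemma q1_le:
  assumes "0 \<le> lam" "lam \<le> 1/4"
  shows "q1 lam \<le> 1 - lam"
proof (rule q1_leI)
  fix x :: real assume x: "0 < x"
  have "\<bar>sin (x / 2)\<bar> \<le> \<bar>x / 2\<bar>" by (rule abs_sin_x_le_abs_x)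
  then have "(sin (x / 2))\<^sup>2 \<le> (x / 2)\<^sup>2" by (simp only: abs_le_square_iff)
  then have 1: "2 * (1 - cos x) \<le> x\<^sup>2"
    using cos_double_sin[of "x / 2"] by (simp add: power_divide)
  \<comment> \<open>The inequality is affine in \<open>lam\<close>, so the cases \<open>lam = 0\<close> and \<open>lam = 1/4\<close> suffice.\<close>
  have "2 * (1 - cos x) - 2 * lam * (x * sin x) \<le> (1 - 2 * lam) * x\<^sup>2"
  proof -
    have "(1 - 4 * lam) * (2 * (1 - cos x)) \<le> (1 - 4 * lam) * x\<^sup>2"
      using 1 assms by (intro mult_left_mono) auto
    moreover have "2 * lam * (4 * (1 - cos x) - x * sin x) \<le> 2 * lam * x\<^sup>2"
      using four_one_minus_cos_less[OF x] assms by (intro mult_left_mono) auto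
    ultimately show ?thesis by (simp add: algebra_simps)
  qed
  then have "ratio_sq lam x * x\<^sup>2 \<le> (1 - lam)\<^sup>2 * x\<^sup>2"
    unfolding ratio_sq_mult[OF less_imp_neq[OF x, symmetric]] by (simp add: algebra_simps power2_eq_square)
  then have "ratio_sq lam x \<le> (1 - lam)\<^sup>2" using x by simp
  then show "sqrt (ratio_sq lam x) \<le> 1 - lam"
    using assms by (intro real_le_lsqrt) auto
qed

lemma ratio_sq_lim: "(ratio_sq lam \<longlongrightarrow> (1 - lam)\<^sup>2) (at_right 0)"
proof -
  have "((\<lambda>x::real. 2 * (1 - cos x) / x\<^sup>2) \<longlongrightarrow> 1) (at_right 0)" by real_asymp
  moreover have "((\<lambda>x::real. sin x / x) \<longlongrightarrow> 1) (at_right 0)" by real_asymp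
  ultimately have "((\<lambda>x. 2 * (1 - cos x) / x\<^sup>2 - 2 * lam * (sin x / x) + lam\<^sup>2) \<longlongrightarrow> 1 - 2 * lam * 1 + lam\<^sup>2) (at_right 0)"
    by (intro tendsto_intros)
  then show ?thesis by (simp add: ratio_sq_def[abs_def] power2_eq_square algebra_simps)
qed

text \<open>The bound is the limit of the quotient as x tends to 0, in accordance with the
  convention \<open>theta1 lam = 0\<close> up to 1/4.\<close>

lemma q1_ge: "lam \<le> 1 \<Longrightarrow> 1 - lam \<le> q1 lam"
proof -
  assume lam: "lam \<le> 1"
  have "((\<lambda>x. sqrt (ratio_sq lam x)) \<longlongrightarrow> sqrt ((1 - lam)\<^sup>2)) (at_right 0)"
    by (intro tendsto_intros ratio_sq_lim)
  then have "sqrt ((1 - lam)\<^sup>2) \<le> q1 lam"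
    by (rule tendsto_upperbound)
      (auto intro!: eventually_at_right_less[THEN eventually_mono] sqrt_ratio_sq_le_q1)
  then show ?thesis using lam by simp
qed

section \<open>Locating the maximizer\<close>

text \<open>Identifies the equation in \<open>is_theta1\<close> as the condition for a stationary
  point of \<open>ratio_sq lam\<close>.\<close>

lemma ratio_sq_deriv:
  assumes "x \<noteq> 0"
  shows "(ratio_sq lam has_real_derivative
     2 * (cos x * (2 - lam * x\<^sup>2) + (1 + lam) * x * sin x - 2) / x ^ 3) (at x)"
proof -
  have "(ratio_sq lam has_real_derivative
      (2 * sin x * x\<^sup>2 - 2 * (1 - cos x) * (2 * x)) / (x\<^sup>2 * x\<^sup>2)
        - (2 * lam * cos x * x - 2 * lam * sin x) / (x * x)) (at x)"
    unfolding ratio_sq_def[abs_def] using assms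
    by (auto intro!: derivative_eq_intros simp: mult_ac)
  moreover have "(2 * sin x * x\<^sup>2 - 2 * (1 - cos x) * (2 * x)) / (x\<^sup>2 * x\<^sup>2)
        - (2 * lam * cos x * x - 2 * lam * sin x) / (x * x)
      = 2 * (cos x * (2 - lam * x\<^sup>2) + (1 + lam) * x * sin x - 2) / x ^ 3"
    using assms by (simp add: field_simps) (simp add: algebra_simps eval_nat_numeral)?
  ultimately show ?thesis by simp
qed

lemma crit_denominator_pos:
  "x \<in> {0<..<pi} \<Longrightarrow> 0 < x * sin x - x\<^sup>2 * cos x"
  using mult_pos_pos[of x "sin x - x * cos x"] x_cos_less_sin[of x]
  by (simp add: algebra_simps power2_eq_square)

lemma theta1_equation_eq_crit:
  assumes "x \<in> {0<..<pi}"
  shows "cos x * (2 - lam * x\<^sup>2) + (1 + lam) * x * sin x - 2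
      = (x * sin x - x\<^sup>2 * cos x) * (lam - crit x)"
proof -
  have "(x * sin x - x\<^sup>2 * cos x) * crit x = 2 - 2 * cos x - x * sin x"
    using crit_denominator_pos[OF assms] by (simp add: crit_def)
  then show ?thesis by (simp add: algebra_simps)
qed

lemma is_theta1_iff: "is_theta1 lam x \<longleftrightarrow> x \<in> {0<..<pi} \<and> crit x = lam"
  using crit_denominator_pos[of x] theta1_equation_eq_crit[of x lam] by (auto simp: is_theta1_def)

text \<open>As \<open>crit\<close> increases, the derivative of \<open>ratio_sq (crit t)\<close> is
  positive before \<open>t\<close> and negative after it.\<close>

lemma ratio_sq_less_at_crit:
  assumes t: "t \<in> {0<..<pi}" and x: "x \<in> {0<..<pi}" and "x \<noteq> t"
  shows "ratio_sq (crit t) x < ratio_sq (crit t) t"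
proof -
  have D: "(ratio_sq (crit t) has_real_derivative
      2 * ((y * sin y - y\<^sup>2 * cos y) * (crit t - crit y)) / y ^ 3) (at y)" if "y \<in> {0<..<pi}" for y
    using ratio_sq_deriv[of y "crit t"] that unfolding theta1_equation_eq_crit[OF that] by simp
  have cont: "continuous_on {a..b} (ratio_sq (crit t))" if "a \<in> {0<..<pi}" "b \<in> {0<..<pi}" for a b
    using that D by (intro DERIV_atLeastAtMost_imp_continuous_on) (metis greaterThanLessThan_iff order.strict_trans1 order.strict_trans2)
  consider "x < t" | "t < x" using \<open>x \<noteq> t\<close> by linarith
  then show ?thesis
  proof cases
    case 1
    then show ?thesis
    proof (rule DERIV_pos_imp_increasing_open)
      fix y assume y: "x < y" "y < t"
      then have "y \<in> {0<..<pi}" using x t by auto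
      moreover from this have "crit y < crit t"
        using y t by (intro strict_mono_onD[OF crit_strict_mono]) auto
      ultimately have "0 < 2 * ((y * sin y - y\<^sup>2 * cos y) * (crit t - crit y)) / y ^ 3"
        using crit_denominator_pos[of y] by simp
      then show "\<exists>d. (ratio_sq (crit t) has_real_derivative d) (at y) \<and> 0 < d"
        using D \<open>y \<in> {0<..<pi}\<close> by blast
    qed (use cont x t in auto)
  next
    case 2
    then show ?thesis
    proof (rule DERIV_neg_imp_decreasing_open)
      fix y assume y: "t < y" "y < x"
      then have "y \<in> {0<..<pi}" using x t by auto
      moreover from this have "crit t < crit y"
        using y t by (intro strict_mono_onD[OF crit_strict_mono]) auto
      ultimately have "2 * ((y * sin y - y\<^sup>2 * cos y) * (crit t - crit y)) / y ^ 3 < 0"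
        using crit_denominator_pos[of y] by (intro divide_neg_pos mult_pos_neg) auto
      then show "\<exists>d. (ratio_sq (crit t) has_real_derivative d) (at y) \<and> d < 0"
        using D \<open>y \<in> {0<..<pi}\<close> by blast
    qed (use cont x t in auto)
  qed
qed

text \<open>The constants are matched to the later comparison: 0.311 exceeds
  \<open>lambda_star\<close>, and \<open>0.428 + 0.3109\<^sup>2\<close> is below the square of
  0.724611, a lower bound for \<open>sin theta1_star\<close>.\<close>

lemma ratio_sq_far:
  assumes "0 \<le> lam" "lam \<le> 0.311" "pi \<le> x"
  shows "ratio_sq lam x \<le> 0.428 + lam\<^sup>2"
proof -
  define y where "y = x - pi"
  \<comment> \<open>Taking the positive part of \<open>- sin x\<close> allows \<open>lam\<close> to
    be replaced by its upper bound 0.311.\<close>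
  define w where "w = max 0 (- sin x)"
  have y: "0 \<le> y" and x: "x = pi + y" and "0 < x"
    using assms pi_gt_zero unfolding y_def by linarith+
  have w: "0 \<le> w" "w \<le> 1" "w \<le> y" "- sin x \<le> w"
    using sin_x_le_x[OF y] y sin_ge_minus_one[of x] by (auto simp: w_def x)
  have "3.14 * 3.14 \<le> pi * pi"
    by (intro mult_mono) (use pi_approx in simp_all)
  then have pi: "9.85 \<le> pi * pi" by simp
  \<comment> \<open>This is the claim times 1000, with \<open>4 \<ge> 2 * (1 - cos x)\<close> and
    \<open>0.622 = 2 * 0.311\<close>. Near \<open>pi\<close> the bound \<open>w \<le> y\<close> is
    used, farther out \<open>w \<le> 1\<close>.\<close>
  have main: "4000 + 622 * (x * w) \<le> 428 * (x * x)"
  proof (cases "y \<le> 3")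
    case True
    have "x * w \<le> x * y" using w \<open>0 < x\<close> by (intro mult_left_mono) auto
    moreover have "y * y \<le> 3 * y" using True y by (intro mult_right_mono) auto
    moreover have "3 * y \<le> pi * y" using pi_gt3 y by (intro mult_right_mono) auto
    moreover have "x * y = pi * y + y * y" "x * x = pi * pi + 2 * (pi * y) + y * y"
      by (simp_all add: x algebra_simps)
    ultimately show ?thesis using pi y by simp
  next
    case False
    then have "6 \<le> x" using pi_gt3 x by linarith
    moreover have "x * w \<le> x * 1" using w \<open>0 < x\<close> by (intro mult_left_mono) auto
    moreover have "6 * x \<le> x * x" using \<open>6 \<le> x\<close> by (intro mult_right_mono) auto
    ultimately show ?thesis by linarith
  qed
  have "lam * (x * - sin x) \<le> lam * (x * w)"
    using w assms \<open>0 < x\<close> by (intro mult_left_mono) auto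
  also have "\<dots> \<le> 311/1000 * (x * w)"
    using w assms \<open>0 < x\<close> by (intro mult_right_mono) auto
  finally have "lam * (x * - sin x) \<le> 311/1000 * (x * w)" .
  then have "2 * (lam * (x * - sin x)) \<le> 622/1000 * (x * w)"
    by simp
  moreover have "2 * (1 - c) \<le> 4" if "-1 \<le> c" for c :: real
    using that by simp
  note this[OF cos_ge_minus_one[of x]]
  ultimately have "2 * (1 - cos x) + 2 * (lam * (x * - sin x)) \<le> 4 + 622/1000 * (x * w)"
    by (intro add_mono)
  also have "4 + 622/1000 * p \<le> 0.428 * q" if "4000 + 622 * p \<le> 428 * q" for p q :: real
    using that by simp
  note this[OF main]
  finally have "ratio_sq lam x * x\<^sup>2 \<le> (0.428 + lam\<^sup>2) * x\<^sup>2"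
    using ratio_sq_mult[of x lam] \<open>0 < x\<close> by (simp add: algebra_simps power2_eq_square)
  then show ?thesis using \<open>0 < x\<close> by simp
qed

text \<open>Near 0, \<open>ratio_sq lam x\<close> is
  \<open>(1 - lam)\<^sup>2 + (lam / 3 - 1 / 12) * x\<^sup>2\<close> up to higher order, and the
  second coefficient is positive for \<open>lam > 1/4\<close>. For \<open>lam > 1\<close> the left
  side is negative.\<close>

lemma q1_gt:
  assumes "1/4 < lam"
  shows "1 - lam < q1 lam"
proof (cases "lam \<le> 1")
  case True
  have "((\<lambda>x::real. 2 * (1 - cos x) / x^4 - 1 / x\<^sup>2) \<longlongrightarrow> - 1 / 12) (at_right 0)" by real_asymp
  moreover have "((\<lambda>x::real. 1 / x\<^sup>2 - sin x / x ^ 3) \<longlongrightarrow> 1 / 6) (at_right 0)" by real_asymp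
  ultimately have "((\<lambda>x. 2 * (1 - cos x) / x^4 - 1 / x\<^sup>2 + 2 * lam * (1 / x\<^sup>2 - sin x / x ^ 3))
      \<longlongrightarrow> - 1 / 12 + 2 * lam * (1 / 6)) (at_right 0)"
    by (intro tendsto_intros)
  then have "eventually (\<lambda>x. 0 < 2 * (1 - cos x) / x^4 - 1 / x\<^sup>2 + 2 * lam * (1 / x\<^sup>2 - sin x / x ^ 3)) (at_right 0)"
    by (rule order_tendstoD) (use assms in simp)
  moreover have "eventually (\<lambda>x::real. 0 < x) (at_right 0)" by (rule eventually_at_right_less)
  ultimately have "eventually (\<lambda>x. 0 < x \<and> (1 - lam)\<^sup>2 < ratio_sq lam x) (at_right 0)"
  proof eventually_elim
    case (elim x)
    then have "0 < x\<^sup>2 * (2 * (1 - cos x) / x^4 - 1 / x\<^sup>2 + 2 * lam * (1 / x\<^sup>2 - sin x / x ^ 3))" by simp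
    also have "\<dots> = ratio_sq lam x - (1 - lam)\<^sup>2"
      using elim by (simp add: ratio_sq_def field_simps eval_nat_numeral)
    finally show ?case using elim by simp
  qed
  then obtain x where "0 < x" "(1 - lam)\<^sup>2 < ratio_sq lam x"
    using eventually_happens'[OF trivial_limit_at_right_real] by blast
  then have "1 - lam < sqrt (ratio_sq lam x)" by (intro real_less_rsqrt)
  also have "\<dots> \<le> q1 lam" using \<open>0 < x\<close> by (rule sqrt_ratio_sq_le_q1)
  finally show ?thesis .
next
  case False
  have "0 \<le> sqrt (ratio_sq lam 1)" by (simp add: ratio_sq_eq)
  also have "\<dots> \<le> q1 lam" by (rule sqrt_ratio_sq_le_q1) simp
  finally show ?thesis using False by linarith
qed

section \<open>The point \<open>theta1_star\<close> and the value \<open>lambda_star\<close>\<close>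

text \<open>The left side of the equation has derivative \<open>x * cos x\<close>: it rises from 0
  up to \<open>pi / 2\<close> and then falls, so at most one root exists. The sign change between
  the two rationals yields existence and bounds together.\<close>

lemma theta1_star_ex1: "\<exists>!x. is_theta1_star x"
  and theta1_star_bounds: "4217/1809 < theta1_star" "theta1_star < 4569/1960"
proof -
  define w :: "real \<Rightarrow> real" where "w x = x * sin x + cos x - 1" for x
  have w': "(w has_real_derivative x * cos x) (at x)" for x
    unfolding w_def[abs_def] by (auto intro!: derivative_eq_intros)
  have "\<exists>x\<ge>4217/1809. x \<le> 4569/1960 \<and> w x = 0"
  proof (rule IVT2)
    show "w (4569/1960) \<le> 0" "0 \<le> w (4217/1809)"
      using sin_cos_numeric_left sin_cos_numeric_right by (simp_all add: w_def)
    show "\<forall>x. 4217/1809 \<le> x \<and> x \<le> 4569/1960 \<longrightarrow> isCont w x"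
      using w' DERIV_isCont by blast
  qed simp
  then obtain t where t: "4217/1809 \<le> t" "t \<le> 4569/1960" "w t = 0" by blast
  then have "is_theta1_star t"
    using pi_gt3 by (simp add: is_theta1_star_def w_def)
  moreover have "x = y" if "is_theta1_star x" "is_theta1_star y" for x y
    using that
  proof (induction x y rule: linorder_wlog)
    case (le x y)
    then have xy: "x \<in> {0<..<pi}" "y \<in> {0<..<pi}" "w x = 0" "w y = 0"
      by (auto simp: is_theta1_star_def w_def)
    have "pi / 2 < x"
    proof (rule ccontr)
      assume "\<not> pi / 2 < x"
      then have "w 0 < w x"
        using xy by (intro less_of_deriv_pos[OF _ w'] mult_pos_pos cos_gt_zero) auto
      then show False using xy by (simp add: w_def)
    qed
    show "x = y"
    proof (rule ccontr)
      assume "x \<noteq> y"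
      have "w y < w x"
      proof (rule DERIV_neg_imp_decreasing[where f = w and a = x and b = y])
        fix z assume "x \<le> z" "z \<le> y"
        then have "z * cos z < 0"
          using \<open>pi / 2 < x\<close> xy cos_monotone_0_pi[of "pi / 2" z] by (intro mult_pos_neg) auto
        then show "\<exists>d. (w has_real_derivative d) (at z) \<and> d < 0" using w' by blast
      qed (use le \<open>x \<noteq> y\<close> in auto)
      then show False using xy by simp
    qed
  qed auto
  ultimately show ex1: "\<exists>!x. is_theta1_star x" by blast
  then have "theta1_star = t"
    unfolding theta1_star_def using \<open>is_theta1_star t\<close> by (intro the1_equality)
  moreover have "t \<noteq> 4217/1809" "t \<noteq> 4569/1960"
    using sin_cos_numeric_left(2) sin_cos_numeric_right(2) t(3) unfolding w_def by (metis less_irrefl)+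
  ultimately show "4217/1809 < theta1_star" "theta1_star < 4569/1960" using t by auto
qed

lemma theta1_star_mem: "theta1_star \<in> {0<..<pi}"
  and theta1_star_eq: "theta1_star * sin theta1_star = 1 - cos theta1_star"
  using theI'[OF theta1_star_ex1] by (auto simp: is_theta1_star_def theta1_star_def)

lemma sin_theta1_star_bounds:
  "0.724611 < sin theta1_star" "sin theta1_star < 0.7246117"
proof -
  have anti: "sin y < sin x" if "pi / 2 \<le> x" "x < y" "y \<le> pi" for x y :: real
    using cos_monotone_0_pi[of "x - pi / 2" "y - pi / 2"] that by (simp add: cos_diff)
  have pi: "pi / 2 < 4217/1809" "4569/1960 < pi" using pi_approx by simp_all
  show "0.724611 < sin theta1_star"
    using sin_cos_numeric_right(1) anti[of theta1_star "4569/1960"] theta1_star_bounds pi by linarith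
  show "sin theta1_star < 0.7246117"
    using sin_cos_numeric_left(1) anti[of "4217/1809" theta1_star] theta1_star_bounds pi by linarith
qed

lemma lambda_star_bounds: "0.3108 < lambda_star" "lambda_star < 0.3109"
  using theta1_star_bounds sin_theta1_star_bounds
  by (simp_all add: lambda_star_def field_simps)

text \<open>The equation \<open>x * sin x = 1 - cos x\<close> combined with
  \<open>sin\<^sup>2 = (1 - cos) * (1 + cos)\<close> gives \<open>sin x = x * (1 + cos x)\<close>;
  the denominator of \<open>crit\<close> then becomes \<open>x\<^sup>2\<close> and the numerator
  \<open>x * sin x\<close>.\<close>

lemma crit_theta1_star: "crit theta1_star = lambda_star"
proof -
  define x where "x = theta1_star"
  have x: "0 < x" "x < pi" and eq: "x * sin x = 1 - cos x"
    using theta1_star_mem theta1_star_eq by (auto simp: x_def)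
  have s: "sin x > 0" using x by (rule sin_gt_zero)
  have "sin x * sin x = (1 - cos x) * (1 + cos x)"
    using sin_cos_squared_add[of x] by (simp add: algebra_simps power2_eq_square)
  also have "\<dots> = sin x * (x * (1 + cos x))" by (simp add: eq[symmetric])
  finally have "sin x = x * (1 + cos x)" using s by simp
  then have "x * sin x - x\<^sup>2 * cos x = x * x" by (simp add: algebra_simps power2_eq_square)
  moreover have "2 - 2 * cos x - x * sin x = x * sin x" using eq by simp
  ultimately have "crit x = sin x / x" using x by (simp add: crit_def)
  then show ?thesis by (simp add: lambda_star_def x_def)
qed

text \<open>By the defining equation the real part of the quotient at \<open>theta1_star\<close> is
  \<open>- sin theta1_star\<close>. This yields a lower bound for \<open>q1 lam\<close> at every
  \<open>lam\<close>.\<close>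

lemma ratio_sq_theta1_star:
  "ratio_sq lam theta1_star = (sin theta1_star)\<^sup>2 + (lambda_star - lam)\<^sup>2"
proof -
  have t: "theta1_star \<noteq> 0" using theta1_star_mem by auto
  have "cos theta1_star - 1 = - sin theta1_star * theta1_star"
    using theta1_star_eq by (simp add: algebra_simps)
  then have "(cos theta1_star - 1) / theta1_star = - sin theta1_star"
    using t by simp
  moreover have "(sin theta1_star - lam * theta1_star) / theta1_star = lambda_star - lam"
    using t by (simp add: lambda_star_def diff_divide_distrib)
  ultimately show ?thesis using t by (simp add: ratio_sq_eq)
qed

section \<open>The root \<open>theta1\<close> and the formula for \<open>q1\<close>\<close>

text \<open>Existence by intermediate values of \<open>crit\<close> between a point near 0, where it
  is close to 1/4, and \<open>theta1_star\<close>; uniqueness since \<open>crit\<close> is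
  injective.\<close>

lemma theta1_ex1:
  assumes "1/4 < lam" "lam \<le> lambda_star"
  shows "\<exists>!x. is_theta1 lam x"
proof -
  have "eventually (\<lambda>x. crit x < lam) (at_right 0)"
    using crit_lim assms(1) by (rule order_tendstoD)
  moreover have "eventually (\<lambda>x. x \<in> {0<..<theta1_star}) (at_right 0)"
    using theta1_star_mem by (intro eventually_at_right_real) auto
  ultimately have "eventually (\<lambda>x. crit x < lam \<and> x \<in> {0<..<theta1_star}) (at_right 0)"
    by eventually_elim auto
  then obtain e where e: "crit e < lam" "e \<in> {0<..<theta1_star}"
    using eventually_happens'[OF trivial_limit_at_right_real] by blast
  have "\<exists>x\<ge>e. x \<le> theta1_star \<and> crit x = lam"
  proof (rule IVT')
    have "x * sin x - x\<^sup>2 * cos x \<noteq> 0" if "x \<in> {e..theta1_star}" for x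
      using crit_denominator_pos[of x] that e theta1_star_mem by auto
    then show "continuous_on {e..theta1_star} crit"
      unfolding crit_def[abs_def] by (intro continuous_intros) auto
  qed (use e assms crit_theta1_star in auto)
  then obtain x where "e \<le> x" "x \<le> theta1_star" "crit x = lam" by blast
  moreover from this have "x \<in> {0<..<pi}" using e theta1_star_mem by auto
  moreover have "x = y" if "x \<in> {0<..<pi}" "y \<in> {0<..<pi}" "crit x = crit y" for x y
    using that inj_onD[OF strict_mono_on_imp_inj_on[OF crit_strict_mono]] by blast
  ultimately show ?thesis unfolding is_theta1_iff by metis
qed

lemma theta1:
  assumes "1/4 < lam" "lam \<le> lambda_star"
  shows "theta1 lam \<in> {0<..<pi}" "crit (theta1 lam) = lam"
proof -
  have "is_theta1 lam (theta1 lam)"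
    using theI'[OF theta1_ex1[OF assms]] assms(1) by (simp add: theta1_def)
  then show "theta1 lam \<in> {0<..<pi}" "crit (theta1 lam) = lam"
    by (auto simp: is_theta1_iff)
qed

lemma theta1_lambda_star: "theta1 lambda_star = theta1_star"
  using theta1_ex1[of lambda_star] theta1[of lambda_star] lambda_star_bounds
    theta1_star_mem crit_theta1_star unfolding is_theta1_iff by auto

lemma q1_eq_sqrt_ratio_sq:
  assumes "1/4 < lam" "lam \<le> lambda_star"
  shows "q1 lam = sqrt (ratio_sq lam (theta1 lam))"
proof (rule antisym)
  note t = theta1[OF assms]
  have near: "ratio_sq lam x \<le> ratio_sq lam (theta1 lam)" if "x \<in> {0<..<pi}" for x
    using ratio_sq_less_at_crit[OF t(1) that] t(2) by (cases "x = theta1 lam") auto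
  show "q1 lam \<le> sqrt (ratio_sq lam (theta1 lam))"
  proof (rule q1_leI)
    fix x :: real assume x: "0 < x"
    have "ratio_sq lam x \<le> ratio_sq lam (theta1 lam)"
    proof (cases "x < pi")
      case True
      then show ?thesis using x near by simp
    next
      case False
      then have "ratio_sq lam x \<le> 0.428 + lam\<^sup>2"
        using assms lambda_star_bounds by (intro ratio_sq_far) auto
      also have "lam\<^sup>2 \<le> 0.3109\<^sup>2"
        using assms lambda_star_bounds by (intro power_mono) auto
      \<comment> \<open>The value at \<open>theta1_star\<close>, in general not the maximizer for
        this \<open>lam\<close>, already beats everything beyond \<open>pi\<close>.\<close>
      also have "0.428 + 0.3109\<^sup>2 \<le> (0.724611::real)\<^sup>2" by (simp add: power2_eq_square)
      also have "\<dots> \<le> (sin theta1_star)\<^sup>2"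
        using sin_theta1_star_bounds by (intro power_mono) auto
      also have "\<dots> \<le> ratio_sq lam theta1_star" by (simp add: ratio_sq_theta1_star)
      also have "\<dots> \<le> ratio_sq lam (theta1 lam)" using theta1_star_mem by (rule near)
      finally show ?thesis by simp
    qed
    then show "sqrt (ratio_sq lam x) \<le> sqrt (ratio_sq lam (theta1 lam))" by simp
  qed
  show "sqrt (ratio_sq lam (theta1 lam)) \<le> q1 lam"
    using t(1) by (intro sqrt_ratio_sq_le_q1) auto
qed

lemma q1_lambda_star: "q1 lambda_star = sin theta1_star"
  using q1_eq_sqrt_ratio_sq[of lambda_star] lambda_star_bounds sin_theta1_star_bounds
  by (simp add: theta1_lambda_star ratio_sq_theta1_star)

lemma q1_lambda_star_less:
  assumes "lam \<noteq> lambda_star"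
  shows "q1 lambda_star < q1 lam"
proof -
  have "sin theta1_star < sqrt (ratio_sq lam theta1_star)"
    using assms by (intro real_less_rsqrt) (simp add: ratio_sq_theta1_star)
  also have "\<dots> \<le> q1 lam"
    using theta1_star_mem by (intro sqrt_ratio_sq_le_q1) auto
  finally show ?thesis by (simp add: q1_lambda_star)
qed

lemma q1_eq_one_minus:
  assumes "0 \<le> lam" "lam \<le> 1/4"
  shows "q1 lam = 1 - lam"
  using q1_le[OF assms] q1_ge[of lam] assms by linarith

section \<open>Strict monotonicity from convexity\<close>

text \<open>The graph lies below the chord from \<open>a\<close> to \<open>c\<close>, which descends
  strictly.\<close>

lemma convex_between_less:
  fixes f :: "real \<Rightarrow> real"
  assumes "convex_on UNIV f" "a < b" "b < c" "f c < f a"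
  shows "f b < f a"
proof -
  define t where "t = (b - a) / (c - a)"
  have t: "0 < t" "t < 1" using assms by (auto simp: t_def field_simps)
  have "t * (c - a) = b - a" using assms by (simp add: t_def)
  then have "(1 - t) * a + t * c = b" by (simp add: algebra_simps)
  then have "f b \<le> (1 - t) * f a + t * f c"
    using convex_onD[OF assms(1), of t a c] t by simp
  also have "\<dots> < f a"
    using mult_strict_left_mono[OF assms(4) t(1)] by (simp add: algebra_simps)
  finally show ?thesis .
qed

lemma q1_strict_antimono: "strict_antimono_on {0..lambda_star} q1"
proof (rule monotone_onI)
  fix a b assume ab: "a \<in> {0..lambda_star}" "b \<in> {0..lambda_star}" "a < b"
  then show "q1 b < q1 a"
    using q1_lambda_star_less[of a] convex_between_less[OF convex_on_q1, of a b lambda_star]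
    by (cases "b = lambda_star") auto
qed

lemma add_q1_strict_mono: "strict_mono_on {1/4<..} (\<lambda>lam. lam + q1 lam)"
proof (rule strict_mono_onI)
  fix a b :: real assume ab: "a \<in> {1/4<..}" "b \<in> {1/4<..}" "a < b"
  \<comment> \<open>Reflection turns the claim into a descent, with
    \<open>- b < - a < - (1/4)\<close> and the value 1 of \<open>f\<close> at the last
    point.\<close>
  define f where "f lam = (- lam) + q1 (- lam)" for lam
  have "convex_on UNIV f"
  proof (rule convex_onI)
    fix t x y :: real assume "0 < t" "t < 1"
    then show "f ((1 - t) *\<^sub>R x + t *\<^sub>R y) \<le> (1 - t) * f x + t * f y"
      using convex_onD[OF convex_on_q1, of t "- x" "- y"] by (simp add: f_def algebra_simps)
  qed simp
  then have "f (- a) < f (- b)"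
    by (rule convex_between_less[where c = "- (1/4)"])
      (use ab q1_gt[of b] q1_eq_one_minus[of "1/4"] in \<open>auto simp: f_def\<close>)
  then show "a + q1 a < b + q1 b" by (simp add: f_def)
qed

section \<open>Extremal characterizations of \<open>q1 lambda_star\<close>\<close>

lemma INF_q1: "(INF lam\<in>{0..}. q1 lam) = q1 lambda_star"
proof (rule cInf_eq_minimum)
  show "q1 lambda_star \<in> q1 ` {0..}" using lambda_star_bounds by auto
  show "q1 lambda_star \<le> y" if "y \<in> q1 ` {0..}" for y
    using that q1_lambda_star_less by (metis imageE less_imp_le order_refl)
qed

text \<open>The function is the absolute value of the real part of the quotient, hence at most the
  full norm for \<open>lambda_star\<close>; at \<open>theta1_star\<close> the imaginary part
  vanishes and equality holds.\<close>

lemma SUP_one_minus_cos: "(SUP x\<in>{0<..}. (1 - cos x) / x) = q1 lambda_star"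
proof (rule cSup_eq_maximum)
  have "q1 lambda_star = (1 - cos theta1_star) / theta1_star"
    using theta1_star_mem by (simp add: q1_lambda_star theta1_star_eq[symmetric])
  then show "q1 lambda_star \<in> (\<lambda>x. (1 - cos x) / x) ` {0<..}"
    using theta1_star_mem by auto
  fix y :: real assume "y \<in> (\<lambda>x. (1 - cos x) / x) ` {0<..}"
  then obtain x where x: "0 < x" "y = (1 - cos x) / x" by auto
  have "y\<^sup>2 = ((cos x - 1) / x)\<^sup>2" by (simp add: x power_divide power2_commute)
  also have "\<dots> \<le> ratio_sq lambda_star x" using x by (simp add: ratio_sq_eq)
  finally have "y \<le> sqrt (ratio_sq lambda_star x)" by (rule real_le_rsqrt)
  also have "\<dots> \<le> q1 lambda_star" using x by (intro sqrt_ratio_sq_le_q1) auto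
  finally show "y \<le> q1 lambda_star" .
qed

theorem lemma5:
  shows "(\<exists>!x. is_theta1_star x) \<and> 2.3311 \<le> theta1_star \<and> theta1_star < 2.3312
    \<and> 0.3108 \<le> lambda_star \<and> lambda_star < 0.3109
    \<and> (\<forall>lam. 1/4 < lam \<and> lam \<le> lambda_star \<longrightarrow> (\<exists>!x. is_theta1 lam x))
    \<and> theta1 lambda_star = theta1_star
    \<and> (\<forall>lam. 0 \<le> lam \<and> lam \<le> 1/4 \<longrightarrow> q1 lam = 1 - lam)
    \<and> (\<forall>lam. 1/4 < lam \<and> lam \<le> lambda_star \<longrightarrow>
          q1 lam = (let x = theta1 lam in
            sqrt (((cos x - 1) / x)\<^sup>2 + ((sin x - lam * x) / x)\<^sup>2)))
    \<and> strict_mono_on {1/4<..lambda_star} (\<lambda>lam. lam + q1 lam)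
    \<and> strict_antimono_on {0..lambda_star} q1
    \<and> q1 (1/4) = 3/4
    \<and> (INF lam\<in>{0..}. q1 lam) = q1 lambda_star
    \<and> q1 lambda_star = (SUP x\<in>{0<..}. (1 - cos x) / x)
    \<and> 0.724611 \<le> q1 lambda_star \<and> q1 lambda_star < 0.724612"
proof -
  have "q1 lam = (let x = theta1 lam in
            sqrt (((cos x - 1) / x)\<^sup>2 + ((sin x - lam * x) / x)\<^sup>2))"
    if "1/4 < lam" "lam \<le> lambda_star" for lam
    using theta1[OF that] q1_eq_sqrt_ratio_sq[OF that] by (simp add: Let_def ratio_sq_eq)
  moreover have "strict_mono_on {1/4<..lambda_star} (\<lambda>lam. lam + q1 lam)"
    using add_q1_strict_mono by (rule monotone_on_subset) auto
  moreover have "q1 (1/4) = 3/4"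
    using q1_eq_one_minus[of "1/4"] by simp
  ultimately show ?thesis
    using theta1_star_ex1 theta1_star_bounds lambda_star_bounds theta1_ex1 theta1_lambda_star
      q1_eq_one_minus q1_strict_antimono INF_q1 SUP_one_minus_cos
      q1_lambda_star sin_theta1_star_bounds by auto
qed

end
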